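(* Let $\mathcal L$ be a metric lattice. Then for all $x,y,z\in L$, $$|x+y|+|z|\le|x+z|+|y+z|.$$ As a consequence, for all $x,y,z\in L$, $$d(x,y)\le d'(x,y)\le|x+y|+|x+z|+|y+z|-|x|-|y|-|z|.$$
   Context: A metric lattice is a tuple $\mathcal L=(L,<,+,\cdot,0,1,d)$ where $(L,<)$ is a partially ordered set with minimal element $0$ and maximal element $1$; $+$ (join) and $\cdot$ (meet) are commutative, associative, idempotent; $x\le y$ iff $x+y=y$ iff $xy=x$; and $d$ is a metric on $L$ with $d(1,0)=1$, $d(x+z,y+z)\le d(x,y)$, and $d(x,y)\le d(x+y,0)-d(xy,0)$ for all $x,y,z\in L$. Notation: $|x|:=d(x,0)$ and $d'(x,y):=d(x+y,x)+d(x+y,y)$. *)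

theory Defs
  imports "HOL-Analysis.Abstract_Metric_Spaces" "HOL-Algebra.Ring"
begin

text \<open>
  The record of ring operations from HOL-Algebra is used purely as a signature: it supplies the
  carrier and the operations \<open>\<oplus>\<close> (join), \<open>\<otimes>\<close> (meet), \<open>\<zero>\<close>, \<open>\<one>\<close>. No ring axiom is assumed.
\<close>

record 'a metric_lattice_struct = "'a ring" +
  lattice_less :: "'a \<Rightarrow> 'a \<Rightarrow> bool"
  ldist :: "'a \<Rightarrow> 'a \<Rightarrow> real"

definition lattice_le :: "('a, 'b) metric_lattice_struct_scheme \<Rightarrow> 'a \<Rightarrow> 'a \<Rightarrow> bool"
  where "lattice_le L x y \<longleftrightarrow> lattice_less L x y \<or> x = y"

locale metric_lattice =
  fixes L :: "('a, 'b) metric_lattice_struct_scheme" (structure)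
  assumes irrefl: "irreflp_on (carrier L) (lattice_less L)"
    and trans: "transp_on (carrier L) (lattice_less L)"
    and zero_closed: "\<zero> \<in> carrier L"
    and one_closed: "\<one> \<in> carrier L"
    and zero_least: "x \<in> carrier L \<Longrightarrow> lattice_le L \<zero> x"
    and one_greatest: "x \<in> carrier L \<Longrightarrow> lattice_le L x \<one>"
    and join_closed: "\<lbrakk>x \<in> carrier L; y \<in> carrier L\<rbrakk> \<Longrightarrow> x \<oplus> y \<in> carrier L"
    and meet_closed: "\<lbrakk>x \<in> carrier L; y \<in> carrier L\<rbrakk> \<Longrightarrow> x \<otimes> y \<in> carrier L"
    and join_commute: "\<lbrakk>x \<in> carrier L; y \<in> carrier L\<rbrakk> \<Longrightarrow> x \<oplus> y = y \<oplus> x"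
    and meet_commute: "\<lbrakk>x \<in> carrier L; y \<in> carrier L\<rbrakk> \<Longrightarrow> x \<otimes> y = y \<otimes> x"
    and join_assoc: "\<lbrakk>x \<in> carrier L; y \<in> carrier L; z \<in> carrier L\<rbrakk>
      \<Longrightarrow> (x \<oplus> y) \<oplus> z = x \<oplus> (y \<oplus> z)"
    and meet_assoc: "\<lbrakk>x \<in> carrier L; y \<in> carrier L; z \<in> carrier L\<rbrakk>
      \<Longrightarrow> (x \<otimes> y) \<otimes> z = x \<otimes> (y \<otimes> z)"
    and join_idem: "x \<in> carrier L \<Longrightarrow> x \<oplus> x = x"
    and meet_idem: "x \<in> carrier L \<Longrightarrow> x \<otimes> x = x"
    and le_iff_join: "\<lbrakk>x \<in> carrier L; y \<in> carrier L\<rbrakk> \<Longrightarrow> lattice_le L x y \<longleftrightarrow> x \<oplus> y = y"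
    and le_iff_meet: "\<lbrakk>x \<in> carrier L; y \<in> carrier L\<rbrakk> \<Longrightarrow> lattice_le L x y \<longleftrightarrow> x \<otimes> y = x"
    and metric: "Metric_space (carrier L) (ldist L)"
    and dist_one_zero: "ldist L \<one> \<zero> = 1"
    and dist_join_le: "\<lbrakk>x \<in> carrier L; y \<in> carrier L; z \<in> carrier L\<rbrakk>
      \<Longrightarrow> ldist L (x \<oplus> z) (y \<oplus> z) \<le> ldist L x y"
    and dist_le: "\<lbrakk>x \<in> carrier L; y \<in> carrier L\<rbrakk>
      \<Longrightarrow> ldist L x y \<le> ldist L (x \<oplus> y) \<zero> - ldist L (x \<otimes> y) \<zero>"

definition lnorm :: "('a, 'b) metric_lattice_struct_scheme \<Rightarrow> 'a \<Rightarrow> real"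
  where "lnorm L x = ldist L x \<zero>\<^bsub>L\<^esub>"

definition ldist' :: "('a, 'b) metric_lattice_struct_scheme \<Rightarrow> 'a \<Rightarrow> 'a \<Rightarrow> real"
  where "ldist' L x y = ldist L (x \<oplus>\<^bsub>L\<^esub> y) x + ldist L (x \<oplus>\<^bsub>L\<^esub> y) y"

end

theory Submission imports Defs begin

text \<open>
  On comparable elements the metric is determined by the norm: if \<open>x \<le> y\<close>, then \<open>d(x,y) = |y| - |x|\<close>,
  since the axiom bounding \<open>d\<close> by norms of join and meet gives one inequality and the triangle
  inequality through \<open>0\<close> the other. The fact that joining with a fixed element does not increase
  distances thus becomes a statement about norms: passing from \<open>z\<close> to \<open>y + z\<close> increases the norm
  by at least as much as passing from \<open>x + z\<close> to \<open>x + y + z\<close>, that is,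
  \<open>|x + y + z| + |z| \<le> |x + z| + |y + z|\<close>. The first claim follows because the norm is monotone.
  The same formula for \<open>d\<close> gives \<open>d'(x,y) = 2|x + y| - |x| - |y|\<close>, so the upper bound for \<open>d'\<close>
  is a rearrangement of the first claim; the lower bound is the triangle inequality through
  \<open>x + y\<close>.
\<close>

context metric_lattice
begin

sublocale Metric_space "carrier L" "ldist L"
  by (rule metric)

lemma join_absorb_left:
  assumes "x \<in> carrier L" "y \<in> carrier L"
  shows "x \<oplus> (x \<oplus> y) = x \<oplus> y"
  using assms join_assoc[of x x y] join_idem[of x] by simp

text \<open>
  An increasing pair is written as \<open>x\<close>, \<open>x + y\<close>; this is the form in which all comparable pairs
  arise below.
\<close>
lemma dist_join_eq_norm_diff:
  assumes x: "x \<in> carrier L" and y: "y \<in> carrier L"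
  shows "ldist L (x \<oplus> y) x = lnorm L (x \<oplus> y) - lnorm L x"
proof -
  have xy: "x \<oplus> y \<in> carrier L"
    using x y by (rule join_closed)
  have join: "x \<oplus> (x \<oplus> y) = x \<oplus> y"
    using x y by (rule join_absorb_left)
  then have meet: "x \<otimes> (x \<oplus> y) = x"
    using le_iff_join[OF x xy] le_iff_meet[OF x xy] by simp
  have "ldist L x (x \<oplus> y) \<le> lnorm L (x \<oplus> y) - lnorm L x"
    using dist_le[OF x xy] unfolding join meet lnorm_def .
  moreover have "lnorm L (x \<oplus> y) \<le> ldist L (x \<oplus> y) x + lnorm L x"
    unfolding lnorm_def using triangle[OF xy x zero_closed] .
  ultimately show ?thesis
    using commute[of x "x \<oplus> y"] by linarith
qed

lemma norm_le_norm_join: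
  assumes "x \<in> carrier L" "y \<in> carrier L"
  shows "lnorm L x \<le> lnorm L (x \<oplus> y)"
  using dist_join_eq_norm_diff[OF assms] nonneg[of "x \<oplus> y" x] by linarith

text \<open>
  Both sides of \<open>d((z + y) + x, z + x) \<le> d(z + y, z)\<close> are distances between comparable elements,
  so this contraction property says that the norm has diminishing increments.
\<close>
lemma norm_join3_submodular:
  assumes x: "x \<in> carrier L" and y: "y \<in> carrier L" and z: "z \<in> carrier L"
  shows "lnorm L ((x \<oplus> y) \<oplus> z) + lnorm L z \<le> lnorm L (x \<oplus> z) + lnorm L (y \<oplus> z)"
proof -
  have rearrange: "(z \<oplus> y) \<oplus> x = (x \<oplus> y) \<oplus> z" "(x \<oplus> z) \<oplus> y = (x \<oplus> y) \<oplus> z"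
    using join_assoc[OF z y x] join_commute[OF y x] join_commute[OF z join_closed[OF x y]]
      join_assoc[OF x z y] join_assoc[OF x y z] join_commute[OF z y]
    by simp_all
  have "lnorm L ((x \<oplus> y) \<oplus> z) - lnorm L (x \<oplus> z) = ldist L ((x \<oplus> z) \<oplus> y) (x \<oplus> z)"
    using dist_join_eq_norm_diff[OF join_closed[OF x z] y] unfolding rearrange by simp
  also have "\<dots> = ldist L ((z \<oplus> y) \<oplus> x) (z \<oplus> x)"
    by (simp only: rearrange) (simp only: join_commute[OF x z])
  also have "\<dots> \<le> ldist L (z \<oplus> y) z"
    using join_closed[OF z y] z x by (rule dist_join_le)
  also have "\<dots> = lnorm L (y \<oplus> z) - lnorm L z"
    using dist_join_eq_norm_diff[OF z y] join_commute[OF y z] by simp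
  finally show ?thesis
    by linarith
qed

lemma norm_join_le:
  assumes "x \<in> carrier L" "y \<in> carrier L" "z \<in> carrier L"
  shows "lnorm L (x \<oplus> y) + lnorm L z \<le> lnorm L (x \<oplus> z) + lnorm L (y \<oplus> z)"
  using norm_join3_submodular[OF assms] norm_le_norm_join[of "x \<oplus> y" z] join_closed assms
  by fastforce

lemma ldist'_eq_norms:
  assumes x: "x \<in> carrier L" and y: "y \<in> carrier L"
  shows "ldist' L x y = 2 * lnorm L (x \<oplus> y) - lnorm L x - lnorm L y"
  using dist_join_eq_norm_diff[OF x y] dist_join_eq_norm_diff[OF y x] join_commute[OF y x]
  by (simp add: ldist'_def)

lemma ldist_le_ldist':
  assumes x: "x \<in> carrier L" and y: "y \<in> carrier L"
  shows "ldist L x y \<le> ldist' L x y"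
  using triangle[OF x join_closed[OF x y] y] commute[of x "x \<oplus> y"] by (simp add: ldist'_def)

end

theorem proposition3p7:
  fixes L :: "('a, 'b) metric_lattice_struct_scheme" (structure)
  assumes "metric_lattice L"
  shows "(\<forall>x\<in>carrier L. \<forall>y\<in>carrier L. \<forall>z\<in>carrier L.
            lnorm L (x \<oplus> y) + lnorm L z \<le> lnorm L (x \<oplus> z) + lnorm L (y \<oplus> z))
       \<and> (\<forall>x\<in>carrier L. \<forall>y\<in>carrier L. \<forall>z\<in>carrier L.
            ldist L x y \<le> ldist' L x y \<and>
            ldist' L x y \<le> lnorm L (x \<oplus> y) + lnorm L (x \<oplus> z) + lnorm L (y \<oplus> z)
                             - lnorm L x - lnorm L y - lnorm L z)"
proof -
  interpret metric_lattice L by (rule assms)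
  have "ldist' L x y \<le> lnorm L (x \<oplus> y) + lnorm L (x \<oplus> z) + lnorm L (y \<oplus> z)
          - lnorm L x - lnorm L y - lnorm L z"
    if "x \<in> carrier L" "y \<in> carrier L" "z \<in> carrier L" for x y z
    using norm_join_le[OF that] ldist'_eq_norms[OF that(1,2)] by linarith
  then show ?thesis
    using norm_join_le ldist_le_ldist' by blast
qed

end
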